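(* Let $B$ be a monoid satisfying the cancellation condition that for all $x,y\in B$, $xy=x$ implies $y=e$. Suppose there exist a family $(M_i)_{i\in I}$ of monoids and a monoid homomorphism $f:\prod_{i\in I}M_i\to B$ such that the induced homomorphism $\pi f:\prod_{i\in I}M_i\to B/U(Z(B))$ does not factor through any finite product of ultraproducts of the $M_i$. Then either (a) or (b) below holds: (a) For the group $U(B)$, there exist a family of groups $(G_j)_{j\in J}$ and a group homomorphism $g:\prod_{j\in J}G_j\to U(B)$ for which the induced homomorphism $\prod_{j\in J}G_j\to U(B)/Z(U(B))$ does not factor through the projection to the product of finitely many ultraproducts of the $G_j$; and hence $U(B)$ contains families of elements $(a_S)_{S\subseteq\omega}$, $(b_S)_{S\subseteq\omega}$, indexed by the subsets $S$ of $\omega$, such that: all the elements $a_S$ commute with one another and all the elements $b_S$ commute with one another; for disjoint $S,T\subseteq\omega$, one has $a_S\,a_T=a_{S\cup T}$, $b_S\,b_T=b_{S\cup T}$ and $a_S\,b_T=b_T\,a_S$; and for $S,T\subseteq\omega$ with $\mathrm{card}(S\cap T)=1$, one has $a_S\,b_T\neq b_T\,a_S$. (b) $B$ contains a family of elements $(a_S)$ indexed by the subsets $S\subseteq\omega$, such that: $a_\emptyset=e$, and all the elements $a_S$ $(S\subseteq\omega)$ commute with one another; for disjoint sets $S,T\subseteq\omega$, one has $a_S\,a_T=a_{S\cup T}$; and for sets $S\subsetneq T\subseteq\omega$, $a_T$ is a right multiple of $a_S$, but $a_S$ is not a right multiple of $a_T$.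
   Context: For a monoid $M$, $e$ denotes its identity element, $U(M)$ its group of invertible elements, and $Z(M)$ its center (for a group, the usual center). $U(Z(B))$ is the group of central invertible elements of $B$; $B/U(Z(B))$ is the factor-monoid of orbits of $B$ under multiplication by $U(Z(B))$, and $\pi:B\to B/U(Z(B))$ is the projection. An element $a$ is a right multiple of $c$ if $a=cb$ for some $b\in B$. A homomorphism on $\prod_{i\in I}M_i$ factors through a finite product of ultraproducts of the $M_i$ if, for some finite (possibly empty) family of ultrafilters $\mathcal U_0,\dots,\mathcal U_{n-1}$ on $I$ (principal or not), it is the composite of the natural map $\prod_{i\in I}M_i\to\prod_{i\in I}M_i/\mathcal U_0\times\dots\times\prod_{i\in I}M_i/\mathcal U_{n-1}$ with a homomorphism defined on that product; similarly for groups.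
   Formalization: The homomorphism f is additionally assumed to be surjective onto B; without this the claim fails, e.g. for the inclusion of Z^ω into the semidirect product of Z^ω with the monoid N, where 1 acts by inversion. *)

theory Defs
  imports "HOL-Algebra.Algebra"
begin

text \<open>In HOL-Algebra, \<^const>\<open>hom\<close> asks only for compatibility with multiplication; between monoids
  preservation of the identity is a separate condition (between groups it is automatic).\<close>

definition monoid_hom :: "('a, 'c) monoid_scheme \<Rightarrow> ('b, 'd) monoid_scheme \<Rightarrow> ('a \<Rightarrow> 'b) set"
  where "monoid_hom G H = {h \<in> hom G H. h \<one>\<^bsub>G\<^esub> = \<one>\<^bsub>H\<^esub>}"

definition center :: "('a, 'c) monoid_scheme \<Rightarrow> 'a set"
  where "center B = {z \<in> carrier B. \<forall>x\<in>carrier B. z \<otimes>\<^bsub>B\<^esub> x = x \<otimes>\<^bsub>B\<^esub> z}"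

text \<open>The set \<open>U(Z(B))\<close>; the inverse of a central unit is central, so these are also the units of
  the monoid \<open>Z(B)\<close>. The factor monoid \<open>B/U(Z(B))\<close> is \<open>B Mod central_units B\<close>: the right cosets
  \<open>central_units B #>\<^bsub>B\<^esub> b\<close> are the orbits of \<open>B\<close> under multiplication by \<open>U(Z(B))\<close>, and elementwise
  multiplication of two orbits gives the orbit of the product.\<close>

definition central_units :: "('a, 'c) monoid_scheme \<Rightarrow> 'a set"
  where "central_units B = center B \<inter> Units B"

text \<open>An ultrafilter on the set \<open>I\<close> is an ultrafilter on the type of indices that contains \<open>I\<close>.\<close>

definition ultrafilter_on :: "'i set \<Rightarrow> 'i filter \<Rightarrow> bool"
  where "ultrafilter_on I U \<longleftrightarrow>
    U \<noteq> bot \<and> eventually (\<lambda>i. i \<in> I) U \<and>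
    (\<forall>P. eventually P U \<or> eventually (\<lambda>i. \<not> P i) U)"

definition ultra_rel ::
    "'i set \<Rightarrow> ('i \<Rightarrow> ('m, 'c) monoid_scheme) \<Rightarrow> 'i filter \<Rightarrow> (('i \<Rightarrow> 'm) \<times> ('i \<Rightarrow> 'm)) set"
  where "ultra_rel I M U =
    {(x, y). x \<in> carrier (product_group I M) \<and> y \<in> carrier (product_group I M) \<and>
      eventually (\<lambda>i. x i = y i) U}"

text \<open>Despite its name, \<^const>\<open>product_group\<close> is the componentwise product of any family of
  monoids.\<close>

definition ultraproduct ::
    "'i set \<Rightarrow> ('i \<Rightarrow> ('m, 'c) monoid_scheme) \<Rightarrow> 'i filter \<Rightarrow> ('i \<Rightarrow> 'm) set monoid"
  where "ultraproduct I M U =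
    \<lparr>carrier = carrier (product_group I M) // ultra_rel I M U,
     monoid.mult = (\<lambda>p q. \<Union>x\<in>p. \<Union>y\<in>q. ultra_rel I M U `` {x \<otimes>\<^bsub>product_group I M\<^esub> y}),
     one = ultra_rel I M U `` {\<one>\<^bsub>product_group I M\<^esub>}\<rparr>"

text \<open>The case \<open>n = 0\<close> (the empty product, a trivial monoid) is allowed, and the ultrafilters may be
  principal. If the monoids \<open>M i\<close> and \<open>C\<close> are groups, so are the ultraproducts and their product, and
  \<open>h\<close> is then just a group homomorphism.\<close>

definition factors_through_ultraproducts ::
    "'i set \<Rightarrow> ('i \<Rightarrow> ('m, 'c) monoid_scheme) \<Rightarrow> ('b, 'd) monoid_scheme \<Rightarrow> (('i \<Rightarrow> 'm) \<Rightarrow> 'b) \<Rightarrow> bool"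
  where "factors_through_ultraproducts I M C \<phi> \<longleftrightarrow>
    (\<exists>(n::nat) (U :: nat \<Rightarrow> 'i filter) h.
      (\<forall>k<n. ultrafilter_on I (U k)) \<and>
      h \<in> monoid_hom (product_group {..<n} (\<lambda>k. ultraproduct I M (U k))) C \<and>
      (\<forall>x\<in>carrier (product_group I M).
        \<phi> x = h (\<lambda>k\<in>{..<n}. ultra_rel I M (U k) `` {x})))"

end

theory Submission
  imports Defs "HOL-Library.Disjoint_Sets" "HOL-Library.Nat_Bijection"
begin

text \<open>Call a set \<open>Y\<close> of indices null if \<open>f\<close> sends all elements of the product that are supported on
  \<open>Y\<close> to central units. The null sets form an ideal, and \<open>\<pi> \<circ> f\<close> does not distinguish two elements that
  differ only on a null set. Suppose that the index set is, up to a null set, a disjoint union of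
  finitely many atoms, that is, non-null sets that cannot be split into two non-null pieces. Each atom
  carries the ultrafilter of the sets that contain it up to a null set, and \<open>\<pi> \<circ> f\<close> factors through the
  product of the corresponding ultraproducts (\<open>factors_through_ultraproducts_if_finite_atoms\<close>).
  Otherwise non-null sets can be split off again and again, which gives infinitely many disjoint
  non-null sets (\<open>disjoint_sequence_or_finite_atoms\<close>).

  Arrange these sets as a double sequence \<open>R k m\<close>, and let \<open>T k\<close> be the union of row \<open>k\<close>.

  If every \<open>T k\<close> supports an element \<open>x k\<close> whose image is not a unit, let \<open>a S\<close> be the image of the
  infinite product of the \<open>x k\<close> with \<open>k \<in> S\<close>; it makes sense because the supports are disjoint. By the
  cancellation condition, \<open>a T\<close> dividing \<open>a S\<close> for some \<open>S \<subset> T\<close> would make \<open>a (T - S)\<close>, and with it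
  \<open>f (x n)\<close> for each \<open>n \<in> T - S\<close>, invertible from one side, hence a unit. This is alternative (b)
  (\<open>exponent_hom.divides_strict\<close>).

  If some row \<open>T k\<close> supports only elements with unit images, then every \<open>R k m\<close> supports an \<open>x m\<close> whose
  image is a unit but not central. Since \<open>f\<close> is onto, \<open>f (x m)\<close> fails to commute with some \<open>f y\<close>, and
  only the part \<open>y m\<close> of \<open>y\<close> inside \<open>R k m\<close> can be responsible for that
  (\<open>obtain_exponent_hom_pair\<close>). Infinite products of the \<open>x m\<close> and of the \<open>y m\<close> give the families
  \<open>a\<close> and \<open>b\<close> of alternative (a). All their members are units because the whole row has unit images; this
  is what the double sequence is for.

  The homomorphism \<open>g\<close> of (a) cannot be built inside the product, as the \<open>x m\<close> need not be invertible
  there. But \<open>k \<mapsto> f (\<Prod>m. (x m) ^ (k m))\<close> is a homomorphism from sequences of natural numbers to the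
  group of units, and it extends to sequences of integers by splitting them into positive and negative
  parts. The extension does not factor: given finitely many ultrafilters on the natural numbers, some
  singleton \<open>{n}\<close> belongs to none of them, so the sequence with the single entry \<open>1\<close> at \<open>n\<close> becomes
  trivial in all the ultraproducts, whereas its image \<open>f (x n)\<close> is not central.\<close>

section \<open>Ideals of sets and their atoms\<close>

text \<open>This is the fact that an infinite Boolean algebra contains infinitely many disjoint nonzero
  elements, for the power set of \<open>R\<close> modulo an ideal. Call a set good if it consists, up to a null set,
  of finitely many atoms. A set that is not good is neither null nor an atom, so it splits into two
  non-null pieces, one of which is again not good; descending into that piece forever, the pieces left
  behind form the sequence.\<close>
lemma disjoint_sequence_or_finite_atoms:
  fixes null :: "'a set \<Rightarrow> bool"
  assumes null_empty: "null {}"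
    and null_subset: "\<And>V Y. V \<subseteq> Y \<Longrightarrow> null Y \<Longrightarrow> null V"
    and null_Un: "\<And>V Y. null V \<Longrightarrow> null Y \<Longrightarrow> null (V \<union> Y)"
  obtains (sequence) S :: "nat \<Rightarrow> 'a set" where
      "disjoint_family S" "\<And>n. S n \<subseteq> R" "\<And>n. \<not> null (S n)"
  | (atoms) \<A> where "finite \<A>" "disjoint \<A>" "\<And>A. A \<in> \<A> \<Longrightarrow> A \<subseteq> R"
      "\<And>A. A \<in> \<A> \<Longrightarrow> \<not> null A" "\<And>A V. A \<in> \<A> \<Longrightarrow> null (A \<inter> V) \<or> null (A - V)"
      "null (R - \<Union>\<A>)"
proof -
  define good where "good Y \<longleftrightarrow> (\<exists>\<A>. finite \<A> \<and> disjoint \<A> \<and> (\<forall>A\<in>\<A>. A \<subseteq> Y \<and> \<not> null A \<and>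
      (\<forall>V. null (A \<inter> V) \<or> null (A - V))) \<and> null (Y - \<Union>\<A>))" for Y
  have good_Un: "good (Y \<union> Z)" if "good Y" "good Z" "Y \<inter> Z = {}" for Y Z
  proof -
    obtain \<A> where A: "finite \<A>" "disjoint \<A>" "\<forall>A\<in>\<A>. A \<subseteq> Y \<and> \<not> null A \<and>
      (\<forall>V. null (A \<inter> V) \<or> null (A - V))" "null (Y - \<Union>\<A>)" using \<open>good Y\<close> good_def by auto
    obtain \<B> where B: "finite \<B>" "disjoint \<B>" "\<forall>A\<in>\<B>. A \<subseteq> Z \<and> \<not> null A \<and>
      (\<forall>V. null (A \<inter> V) \<or> null (A - V))" "null (Z - \<Union>\<B>)" using \<open>good Z\<close> good_def by auto
    have "disjoint (\<A> \<union> \<B>)"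
      using A(3) B(3) \<open>Y \<inter> Z = {}\<close> by (intro disjoint_union A(2) B(2)) blast
    moreover have "null (Y \<union> Z - \<Union>(\<A> \<union> \<B>))"
      by (rule null_subset[OF _ null_Un[OF A(4) B(4)]]) auto
    ultimately show ?thesis
      unfolding good_def using A B by (intro exI[of _ "\<A> \<union> \<B>"]) auto
  qed
  have split: "\<exists>Z. \<not> good Z \<and> Z \<subseteq> Y \<and> \<not> null (Y - Z)" if "\<not> good Y" for Y
  proof -
    have "\<not> null Y"
      using that null_empty unfolding good_def by (auto dest!: spec[of _ "{}"])
    then have "\<not> (\<forall>V. null (Y \<inter> V) \<or> null (Y - V))"
      using that null_empty unfolding good_def by (auto dest!: spec[of _ "{Y}"])
    then obtain V where V: "\<not> null (Y \<inter> V)" "\<not> null (Y - V)" by blast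
    have "\<not> good (Y \<inter> V) \<or> \<not> good (Y - V)"
      using that good_Un[of "Y \<inter> V" "Y - V"] by (auto simp: Int_Diff_Un)
    then show ?thesis
    proof
      assume "\<not> good (Y \<inter> V)"
      moreover have "Y - Y \<inter> V = Y - V" by auto
      ultimately show ?thesis using V by (intro exI[of _ "Y \<inter> V"]) auto
    next
      assume "\<not> good (Y - V)"
      moreover have "Y - (Y - V) = Y \<inter> V" by auto
      ultimately show ?thesis using V by (intro exI[of _ "Y - V"]) auto
    qed
  qed
  show thesis
  proof (cases "good R")
    case True
    then show thesis unfolding good_def by (auto intro: atoms)
  next
    case False
    have "\<exists>Z. \<forall>n. (\<not> good (Z n) \<and> Z n \<subseteq> R) \<and> Z (Suc n) \<subseteq> Z n \<and> \<not> null (Z n - Z (Suc n))"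
    proof (rule dependent_nat_choice)
      show "\<exists>Y. \<not> good Y \<and> Y \<subseteq> R" using False by blast
    next
      fix Y and n :: nat assume "\<not> good Y \<and> Y \<subseteq> R"
      then show "\<exists>Z. (\<not> good Z \<and> Z \<subseteq> R) \<and> Z \<subseteq> Y \<and> \<not> null (Y - Z)"
        using split[of Y] by blast
    qed
    then obtain Z where Z: "\<And>n. \<not> good (Z n) \<and> Z n \<subseteq> R"
        and step: "\<And>n. Z (Suc n) \<subseteq> Z n \<and> \<not> null (Z n - Z (Suc n))"
      by auto
    have mono: "Z n \<subseteq> Z m" if "m \<le> n" for m n
      using that step by (rule_tac lift_Suc_antimono_le) auto
    have "disjoint_family (\<lambda>n. Z n - Z (Suc n))"
      unfolding disjoint_family_on_def
    proof (intro ballI impI)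
      fix m n :: nat assume "m \<noteq> n"
      then have "Suc m \<le> n \<or> Suc n \<le> m" by auto
      then show "(Z m - Z (Suc m)) \<inter> (Z n - Z (Suc n)) = {}" using mono by blast
    qed
    then show thesis using Z step by (intro sequence[of "\<lambda>n. Z n - Z (Suc n)"]) auto
  qed
qed

section \<open>Units and central units of a monoid\<close>

context monoid
begin

lemma commute_mult:
  assumes "x \<in> carrier G" "y \<in> carrier G" "z \<in> carrier G" "x \<otimes> z = z \<otimes> x" "y \<otimes> z = z \<otimes> y"
  shows "(x \<otimes> y) \<otimes> z = z \<otimes> (x \<otimes> y)"
proof -
  have "(x \<otimes> y) \<otimes> z = x \<otimes> (z \<otimes> y)" using assms by (simp add: m_assoc)
  also have "\<dots> = (z \<otimes> x) \<otimes> y" using assms(1-3) by (simp add: m_assoc flip: assms(4))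
  finally show ?thesis using assms(1-3) by (simp add: m_assoc)
qed

lemma commute_inv:
  assumes "u \<in> Units G" "x \<in> carrier G" "u \<otimes> x = x \<otimes> u"
  shows "inv u \<otimes> x = x \<otimes> inv u"
proof -
  have u: "u \<in> carrier G" "inv u \<in> carrier G" using assms by auto
  have "inv u \<otimes> x = inv u \<otimes> (x \<otimes> u) \<otimes> inv u"
    using assms(1,2) u by (simp add: m_assoc)
  also have "\<dots> = (inv u \<otimes> u) \<otimes> (x \<otimes> inv u)"
    using assms(2) u by (simp only: assms(3)[symmetric] m_assoc m_closed)
  finally show ?thesis using assms(1,2) u by simp
qed

lemma inv_mult_units:
  assumes "u \<in> Units G" "v \<in> Units G"
  shows "inv (u \<otimes> v) = inv v \<otimes> inv u"
proof (rule inv_unique'[symmetric])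
  note [simp] = assms Units_closed[OF assms(1)] Units_closed[OF assms(2)]
  show "u \<otimes> v \<otimes> (inv v \<otimes> inv u) = \<one>"
    using m_assoc[of v "inv v" "inv u"] by (simp add: m_assoc)
  show "inv v \<otimes> inv u \<otimes> (u \<otimes> v) = \<one>"
    using m_assoc[of "inv u" u v] by (simp add: m_assoc)
qed (use assms in auto)

text \<open>From \<open>x \<otimes> y = \<one>\<close> it follows that \<open>x \<otimes> (y \<otimes> x) = x\<close>, and the cancellation condition
  turns the right inverse \<open>y\<close> into a two-sided one.\<close>
lemma unit_factor:
  assumes cancel: "\<And>x y. x \<in> carrier G \<Longrightarrow> y \<in> carrier G \<Longrightarrow> x \<otimes> y = x \<Longrightarrow> y = \<one>"
    and "x \<in> carrier G" "y \<in> carrier G" "x \<otimes> y = \<one>"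
  shows "x \<in> Units G"
proof -
  have "y \<otimes> x = \<one>"
    using assms(2-4) by (intro cancel[of x]) (auto simp flip: m_assoc)
  then show ?thesis using assms(2-4) by (auto simp: Units_def)
qed

lemma central_units_iff:
  "c \<in> central_units G \<longleftrightarrow> c \<in> Units G \<and> (\<forall>x\<in>carrier G. c \<otimes> x = x \<otimes> c)"
  unfolding central_units_def center_def by blast

lemma central_units_commute:
  "c \<in> central_units G \<Longrightarrow> x \<in> carrier G \<Longrightarrow> c \<otimes> x = x \<otimes> c"
  unfolding central_units_iff by blast

lemma central_units_closed [simp]: "c \<in> central_units G \<Longrightarrow> c \<in> carrier G"
  unfolding central_units_iff by blast

lemma one_central_units [simp]: "\<one> \<in> central_units G"
  unfolding central_units_iff by simp

lemma mult_central_units [simp]: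
  "c \<in> central_units G \<Longrightarrow> d \<in> central_units G \<Longrightarrow> c \<otimes> d \<in> central_units G"
  unfolding central_units_iff by (blast intro: commute_mult)

lemma inv_central_units [simp]: "c \<in> central_units G \<Longrightarrow> inv c \<in> central_units G"
  unfolding central_units_iff by (blast intro: commute_inv Units_inv_Units)

text \<open>Central units can be moved past every element, so the elementwise product of two orbits is again an
  orbit.\<close>
lemma central_units_coset_mult:
  assumes "a \<in> carrier G" "b \<in> carrier G"
  shows "(central_units G #> a) <#> (central_units G #> b) = central_units G #> (a \<otimes> b)"
proof -
  have eq: "(c \<otimes> a) \<otimes> (d \<otimes> b) = (c \<otimes> d) \<otimes> (a \<otimes> b)" if "c \<in> central_units G" "d \<in> central_units G" for c d
  proof -
    have "(c \<otimes> a) \<otimes> (d \<otimes> b) = c \<otimes> (a \<otimes> d) \<otimes> b"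
      using that assms by (simp add: m_assoc)
    also have "\<dots> = c \<otimes> (d \<otimes> a) \<otimes> b"
      using that assms by (simp only: central_units_commute)
    finally show ?thesis using that assms by (simp add: m_assoc)
  qed
  show ?thesis
  proof
    show "(central_units G #> a) <#> (central_units G #> b) \<subseteq> central_units G #> (a \<otimes> b)"
      using mult_central_units by (fastforce simp: r_coset_def set_mult_def eq)
    show "central_units G #> (a \<otimes> b) \<subseteq> (central_units G #> a) <#> (central_units G #> b)"
    proof
      fix y assume "y \<in> central_units G #> (a \<otimes> b)"
      then obtain c where c: "c \<in> central_units G" "y = c \<otimes> (a \<otimes> b)" by (auto simp: r_coset_def)
      then have "y = (c \<otimes> a) \<otimes> (\<one> \<otimes> b)" using assms by (simp add: m_assoc)
      then show "y \<in> (central_units G #> a) <#> (central_units G #> b)"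
        using c one_central_units unfolding r_coset_def set_mult_def by blast
    qed
  qed
qed

lemma central_units_coset_self:
  assumes "c \<in> central_units G"
  shows "central_units G #> c = central_units G"
proof
  show "central_units G #> c \<subseteq> central_units G" using assms by (auto simp: r_coset_def)
  show "central_units G \<subseteq> central_units G #> c"
  proof
    fix d assume d: "d \<in> central_units G"
    have "c \<in> Units G" using assms by (simp add: central_units_iff)
    then have "d = (d \<otimes> inv c) \<otimes> c"
      using central_units_closed[OF d] by (simp add: m_assoc Units_closed)
    then show "d \<in> central_units G #> c"
      using d assms unfolding r_coset_def by (metis UN_I inv_central_units mult_central_units singletonI)
  qed
qed

lemma central_units_coset_absorb:
  assumes "a \<in> carrier G" "c \<in> central_units G"
  shows "central_units G #> (a \<otimes> c) = central_units G #> a"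
proof -
  have "central_units G #> (a \<otimes> c) = (central_units G #> a) <#> (central_units G #> c)"
    using assms by (simp only: central_units_coset_mult central_units_closed)
  also have "\<dots> = (central_units G #> a) <#> (central_units G #> \<one>)"
    using assms by (simp only: central_units_coset_self one_central_units)
  also have "\<dots> = central_units G #> (a \<otimes> \<one>)"
    using assms by (simp only: central_units_coset_mult one_closed)
  finally show ?thesis using assms by simp
qed

end

section \<open>Ultraproducts of monoids\<close>

context
  fixes I :: "'i set" and M :: "'i \<Rightarrow> ('m, 'c) monoid_scheme"
  assumes M: "\<And>i. i \<in> I \<Longrightarrow> monoid (M i)"
begin

lemma product_mult_closed:
  "x \<in> carrier (product_group I M) \<Longrightarrow> y \<in> carrier (product_group I M) \<Longrightarrow>
    x \<otimes>\<^bsub>product_group I M\<^esub> y \<in> carrier (product_group I M)"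
  using monoid.m_closed[OF M] by (auto simp: PiE_def Pi_def)

lemma product_one_closed: "\<one>\<^bsub>product_group I M\<^esub> \<in> carrier (product_group I M)"
  using monoid.one_closed[OF M] by auto

lemma equiv_ultra_rel: "equiv (carrier (product_group I M)) (ultra_rel I M U)"
proof (rule equivI)
  show "ultra_rel I M U \<subseteq> carrier (product_group I M) \<times> carrier (product_group I M)"
    by (auto simp: ultra_rel_def simp del: carrier_product_group)
  show "refl_on (carrier (product_group I M)) (ultra_rel I M U)"
    by (auto simp: refl_on_def ultra_rel_def simp del: carrier_product_group)
  show "sym (ultra_rel I M U)"
    by (auto simp: sym_def ultra_rel_def eq_commute simp del: carrier_product_group)
  show "trans (ultra_rel I M U)"
    by (auto simp: trans_def ultra_rel_def simp del: carrier_product_group elim: eventually_elim2)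
qed

text \<open>Agreement almost everywhere is a congruence, so products of classes can be computed with
  representatives.\<close>
lemma ultraproduct_mult:
  assumes x: "x \<in> carrier (product_group I M)" and y: "y \<in> carrier (product_group I M)"
  shows "ultra_rel I M U `` {x} \<otimes>\<^bsub>ultraproduct I M U\<^esub> ultra_rel I M U `` {y} =
    ultra_rel I M U `` {x \<otimes>\<^bsub>product_group I M\<^esub> y}"
proof -
  let ?P = "product_group I M" and ?r = "ultra_rel I M U"
  have "congruent2 ?r ?r (\<lambda>x y. ?r `` {x \<otimes>\<^bsub>?P\<^esub> y})"
  proof (rule congruent2I')
    fix x1 x2 y1 y2 assume "(x1, x2) \<in> ?r" "(y1, y2) \<in> ?r"
    then have "(x1 \<otimes>\<^bsub>?P\<^esub> y1, x2 \<otimes>\<^bsub>?P\<^esub> y2) \<in> ?r"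
      using product_mult_closed[of x1 y1] product_mult_closed[of x2 y2]
      unfolding ultra_rel_def mem_Collect_eq prod.case
      by (auto simp del: carrier_product_group elim: eventually_elim2)
    then show "?r `` {x1 \<otimes>\<^bsub>?P\<^esub> y1} = ?r `` {x2 \<otimes>\<^bsub>?P\<^esub> y2}"
      by (rule equiv_class_eq[OF equiv_ultra_rel])
  qed
  from UN_equiv_class2[OF equiv_ultra_rel equiv_ultra_rel this x y] show ?thesis
    by (simp add: ultraproduct_def)
qed

end

text \<open>Each ultrafilter contains at most one singleton, so finitely many of them leave some singleton
  \<open>{j}\<close> out, and then \<open>x j\<close> agrees with the identity almost everywhere for all of them.\<close>
lemma not_factors_if_point_supported_images_nontrivial:
  fixes G :: "'j \<Rightarrow> ('g, 'c) monoid_scheme" and C :: "('b, 'd) monoid_scheme"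
  assumes G: "\<And>j. j \<in> J \<Longrightarrow> monoid (G j)" and "infinite J"
    and x: "\<And>j. j \<in> J \<Longrightarrow> x j \<in> carrier (product_group J G)"
    and supp: "\<And>i j. i \<in> J \<Longrightarrow> j \<in> J \<Longrightarrow> i \<noteq> j \<Longrightarrow> x j i = \<one>\<^bsub>G i\<^esub>"
    and ne: "\<And>j. j \<in> J \<Longrightarrow> \<phi> (x j) \<noteq> \<phi> \<one>\<^bsub>product_group J G\<^esub>"
  shows "\<not> factors_through_ultraproducts J G C \<phi>"
proof
  assume "factors_through_ultraproducts J G C \<phi>"
  then obtain n :: nat and U h where U: "\<And>k. k < n \<Longrightarrow> ultrafilter_on J (U k)"
    and h: "\<And>x. x \<in> carrier (product_group J G) \<Longrightarrow>
        \<phi> x = h (\<lambda>k\<in>{..<n}. ultra_rel J G (U k) `` {x})"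
    unfolding factors_through_ultraproducts_def by blast
  let ?bad = "\<lambda>k. {j. eventually (\<lambda>i. i = j) (U k)}"
  have "finite (?bad k)" if "k < n" for k
  proof -
    have "i = j" if "i \<in> ?bad k" "j \<in> ?bad k" for i j
    proof -
      have "eventually (\<lambda>l. l = i \<and> l = j) (U k)" using that by (simp add: eventually_conj_iff)
      moreover have "U k \<noteq> bot" using U[OF \<open>k < n\<close>] by (simp add: ultrafilter_on_def)
      ultimately have "\<exists>l. l = i \<and> l = j" using eventually_happens' by blast
      then show ?thesis by blast
    qed
    then show ?thesis by (metis finite.simps infinite_imp_nonempty is_singletonI' is_singleton_def finite.emptyI)
  qed
  then have "finite (\<Union>k<n. ?bad k)" by blast
  then obtain j where j: "j \<in> J" "j \<notin> (\<Union>k<n. ?bad k)"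
    using \<open>infinite J\<close> by (meson finite_subset subsetI)
  let ?one = "\<one>\<^bsub>product_group J G\<^esub>"
  have one: "?one \<in> carrier (product_group J G)" by (rule product_one_closed[OF G])
  have "ultra_rel J G (U k) `` {x j} = ultra_rel J G (U k) `` {?one}" if "k < n" for k
  proof (rule equiv_class_eq[OF equiv_ultra_rel[OF G]])
    have "eventually (\<lambda>i. i \<noteq> j) (U k)" "eventually (\<lambda>i. i \<in> J) (U k)"
      using U[OF that] j that unfolding ultrafilter_on_def by blast+
    then have "eventually (\<lambda>i. x j i = ?one i) (U k)"
      by eventually_elim (use supp j in auto)
    then show "(x j, ?one) \<in> ultra_rel J G (U k)"
      using x[OF j(1)] one by (simp add: ultra_rel_def)
  qed
  then have "(\<lambda>k\<in>{..<n}. ultra_rel J G (U k) `` {x j}) = (\<lambda>k\<in>{..<n}. ultra_rel J G (U k) `` {?one})"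
    by (intro restrict_ext) auto
  then have "\<phi> (x j) = \<phi> ?one" using h[OF x[OF j(1)]] h[OF one] by simp
  then show False using ne j by blast
qed

section \<open>Homomorphisms from sequences of natural numbers\<close>

abbreviation "\<chi>" :: "nat set \<Rightarrow> nat \<Rightarrow> nat"
  where "\<chi> S \<equiv> \<lambda>n. of_bool (n \<in> S)"

text \<open>A homomorphism from the additive monoid of all sequences of natural numbers. Evaluated at indicator
  functions it gives a family indexed by the sets of natural numbers, whose members commute and are
  multiplicative on disjoint unions. Arbitrary exponents, not only \<open>0\<close> and \<open>1\<close>, are kept because they
  are what makes an extension to sequences of integers possible.\<close>
locale exponent_hom = monoid G for G (structure) +
  fixes \<phi> :: "(nat \<Rightarrow> nat) \<Rightarrow> 'a"
  assumes closed [simp]: "\<phi> k \<in> carrier G"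
    and hom_zero: "\<phi> (\<lambda>_. 0) = \<one>"
    and hom_add: "\<phi> (\<lambda>n. k n + l n) = \<phi> k \<otimes> \<phi> l"
begin

lemma commute: "\<phi> k \<otimes> \<phi> l = \<phi> l \<otimes> \<phi> k"
proof -
  have "(\<lambda>n. k n + l n) = (\<lambda>n. l n + k n)" by (simp add: add.commute)
  then show ?thesis by (simp only: hom_add[symmetric])
qed

lemma union: "S \<inter> T = {} \<Longrightarrow> \<phi> (\<chi> S) \<otimes> \<phi> (\<chi> T) = \<phi> (\<chi> (S \<union> T))"
proof -
  assume "S \<inter> T = {}"
  then have "(\<lambda>n. \<chi> S n + \<chi> T n) = \<chi> (S \<union> T)" by (auto simp: of_bool_def fun_eq_iff)
  then show ?thesis by (simp only: hom_add[symmetric])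
qed

lemma empty: "\<phi> (\<chi> {}) = \<one>"
  using hom_zero by simp

lemma remove_point: "n \<in> S \<Longrightarrow> \<phi> (\<chi> S) = \<phi> (\<chi> {n}) \<otimes> \<phi> (\<chi> (S - {n}))"
  using union[of "{n}" "S - {n}"] by (simp only: Diff_disjoint insert_Diff insert_is_Un[symmetric])

text \<open>If \<open>\<phi> (\<chi> T)\<close> divided \<open>\<phi> (\<chi> S)\<close>, cancelling \<open>\<phi> (\<chi> S)\<close> would give \<open>\<phi> (\<chi> (T - S))\<close>, and hence each of its
  factors \<open>\<phi> (\<chi> {n})\<close>, a right inverse.\<close>
lemma divides_strict:
  assumes cancel: "\<And>x y. x \<in> carrier G \<Longrightarrow> y \<in> carrier G \<Longrightarrow> x \<otimes> y = x \<Longrightarrow> y = \<one>"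
    and nonunit: "\<And>n. \<phi> (\<chi> {n}) \<notin> Units G"
    and "S \<subset> T"
  shows "\<phi> (\<chi> S) divides \<phi> (\<chi> T)" "\<not> \<phi> (\<chi> T) divides \<phi> (\<chi> S)"
proof -
  have T: "\<phi> (\<chi> T) = \<phi> (\<chi> S) \<otimes> \<phi> (\<chi> (T - S))"
    using union[of S "T - S"] \<open>S \<subset> T\<close> by (simp only: Diff_disjoint Diff_partition psubset_imp_subset)
  then show "\<phi> (\<chi> S) divides \<phi> (\<chi> T)" by (auto simp: factor_def)
  show "\<not> \<phi> (\<chi> T) divides \<phi> (\<chi> S)"
  proof
    assume "\<phi> (\<chi> T) divides \<phi> (\<chi> S)"
    then obtain c where c: "c \<in> carrier G" "\<phi> (\<chi> S) = \<phi> (\<chi> T) \<otimes> c" by (auto simp: factor_def)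
    have "\<phi> (\<chi> (T - S)) \<otimes> c = \<one>"
    proof (rule cancel[of "\<phi> (\<chi> S)"])
      show "\<phi> (\<chi> S) \<otimes> (\<phi> (\<chi> (T - S)) \<otimes> c) = \<phi> (\<chi> S)"
        using c by (simp only: T m_assoc closed)
    qed (use c in auto)
    moreover obtain n where "n \<in> T - S" using \<open>S \<subset> T\<close> by blast
    ultimately have "\<phi> (\<chi> {n}) \<otimes> (\<phi> (\<chi> (T - S - {n})) \<otimes> c) = \<one>"
      using c remove_point[of n "T - S"] by (simp add: m_assoc)
    then have "\<phi> (\<chi> {n}) \<in> Units G"
      by (rule unit_factor[rotated 3]) (use cancel c in auto)
    then show False using nonunit by blast
  qed
qed

end

text \<open>The source of alternative (a): \<open>\<phi> (\<chi> S)\<close> and \<open>\<psi> (\<chi> S)\<close> serve as \<open>a S\<close> and \<open>b S\<close>, and an extension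
  of \<open>\<phi>\<close> to sequences of integers serves as \<open>g\<close>.\<close>
locale exponent_hom_pair = \<phi>: exponent_hom G \<phi> + \<psi>: exponent_hom G \<psi> for G (structure) and \<phi> \<psi> +
  assumes \<phi>_units: "\<phi> k \<in> Units G" and \<psi>_units: "\<psi> k \<in> Units G"
    and disjoint_commute: "(\<And>n. k n = 0 \<or> l n = 0) \<Longrightarrow> \<phi> k \<otimes> \<psi> l = \<psi> l \<otimes> \<phi> k"
    and noncommute: "\<phi> (\<chi> {n}) \<otimes> \<psi> (\<chi> {n}) \<noteq> \<psi> (\<chi> {n}) \<otimes> \<phi> (\<chi> {n})"
begin

text \<open>Let \<open>S \<inter> T = {n}\<close>. The factor \<open>\<phi> (\<chi> (S - {n}))\<close> commutes with \<open>\<psi> (\<chi> T)\<close>, and \<open>\<psi> (\<chi> (T - {n}))\<close> with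
  \<open>\<phi> (\<chi> {n})\<close>, by disjointness. Both are units, so cancelling first the one and then the other would
  leave a commutation at \<open>n\<close>.\<close>
lemma not_commute_if_card_Int_eq_1:
  assumes "card (S \<inter> T) = 1"
  shows "\<phi> (\<chi> S) \<otimes> \<psi> (\<chi> T) \<noteq> \<psi> (\<chi> T) \<otimes> \<phi> (\<chi> S)"
proof
  assume eq: "\<phi> (\<chi> S) \<otimes> \<psi> (\<chi> T) = \<psi> (\<chi> T) \<otimes> \<phi> (\<chi> S)"
  obtain n where n: "S \<inter> T = {n}" using assms by (auto simp: card_1_singleton_iff)
  define a a' b b' where "a = \<phi> (\<chi> {n})" and "a' = \<phi> (\<chi> (S - {n}))"
    and "b = \<psi> (\<chi> {n})" and "b' = \<psi> (\<chi> (T - {n}))"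
  have U: "a \<in> Units G" "a' \<in> Units G" "b \<in> Units G" "b' \<in> Units G"
    by (simp_all add: a_def a'_def b_def b'_def \<phi>_units \<psi>_units)
  then have C: "a \<in> carrier G" "a' \<in> carrier G" "b \<in> carrier G" "b' \<in> carrier G" by auto
  have S: "\<phi> (\<chi> S) = a \<otimes> a'" and T: "\<psi> (\<chi> T) = b \<otimes> b'"
    unfolding a_def a'_def b_def b'_def using n by (blast intro: \<phi>.remove_point \<psi>.remove_point)+
  have 1: "a' \<otimes> \<psi> (\<chi> T) = \<psi> (\<chi> T) \<otimes> a'"
    unfolding a'_def using n by (intro disjoint_commute) auto
  have 2: "a \<otimes> b' = b' \<otimes> a"
    unfolding a_def b'_def using n by (intro disjoint_commute) auto
  have "(a \<otimes> \<psi> (\<chi> T)) \<otimes> a' = (\<psi> (\<chi> T) \<otimes> a) \<otimes> a'"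
    using eq 1 C unfolding S by (metis \<phi>.m_assoc \<psi>.closed)
  then have "(a \<otimes> \<psi> (\<chi> T) \<otimes> a') \<otimes> inv a' = (\<psi> (\<chi> T) \<otimes> a \<otimes> a') \<otimes> inv a'" by simp
  then have "a \<otimes> \<psi> (\<chi> T) = \<psi> (\<chi> T) \<otimes> a"
    using C U by (simp add: \<phi>.m_assoc)
  then have "(a \<otimes> b) \<otimes> b' = (b \<otimes> a) \<otimes> b'"
    using C 2 unfolding T by (metis \<phi>.m_assoc)
  then have "(a \<otimes> b \<otimes> b') \<otimes> inv b' = (b \<otimes> a \<otimes> b') \<otimes> inv b'" by simp
  then have "a \<otimes> b = b \<otimes> a"
    using C U by (simp add: \<phi>.m_assoc)
  then show False using noncommute by (simp add: a_def b_def)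
qed

text \<open>The group completion of the monoid of sequences of natural numbers is the group of sequences of
  integers; this is the extension of \<open>\<phi>\<close> to it, on \<open>z\<close> written as the difference of its positive and
  negative parts.\<close>
definition int_extension :: "(nat \<Rightarrow> int) \<Rightarrow> 'a"
  where "int_extension z = \<phi> (\<lambda>n. nat (z n)) \<otimes> inv (\<phi> (\<lambda>n. nat (- z n)))"

text \<open>The positive part of a sum is in general not the sum of the positive parts, so multiplicativity of the
  extension rests on its independence of the way in which \<open>z\<close> is written as a difference.\<close>
lemma int_extension_eqI:
  assumes "\<And>n. z n = int (k n) - int (l n)"
  shows "int_extension z = \<phi> k \<otimes> inv (\<phi> l)"
proof -
  let ?p = "\<phi> (\<lambda>n. nat (z n))" and ?m = "\<phi> (\<lambda>n. nat (- z n))"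
  have *: "nat (z n) + l n = k n + nat (- z n)" for n
    using assms[of n] by linarith
  have eq: "?p \<otimes> \<phi> l = \<phi> k \<otimes> ?m"
    by (simp only: * flip: \<phi>.hom_add)
  have "?p \<otimes> inv ?m = ?p \<otimes> (\<phi> l \<otimes> inv (\<phi> l)) \<otimes> inv ?m"
    by (simp add: \<phi>_units)
  also have "\<dots> = (\<phi> k \<otimes> ?m) \<otimes> inv (\<phi> l) \<otimes> inv ?m"
    by (simp add: \<phi>_units \<phi>.m_assoc flip: eq)
  also have "\<dots> = \<phi> k \<otimes> (inv (\<phi> l) \<otimes> ?m) \<otimes> inv ?m"
    using \<phi>.commute_inv[OF \<phi>_units \<phi>.closed \<phi>.commute] by (simp add: \<phi>_units \<phi>.m_assoc)
  also have "\<dots> = \<phi> k \<otimes> inv (\<phi> l)"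
    by (simp add: \<phi>_units \<phi>.m_assoc)
  finally show ?thesis by (simp add: int_extension_def)
qed

lemma int_extension_hom:
  "int_extension \<in> hom (product_group UNIV (\<lambda>_::nat. integer_group)) (units_of G)"
proof (rule homI)
  show "int_extension z \<in> carrier (units_of G)" for z
    by (simp add: int_extension_def units_of_def \<phi>_units)
  fix z w :: "nat \<Rightarrow> int"
  let ?p = "\<lambda>z. \<phi> (\<lambda>n. nat (z n))" and ?m = "\<lambda>z. \<phi> (\<lambda>n. nat (- z n))"
  have inv_commute: "inv \<phi> k \<otimes> \<phi> l = \<phi> l \<otimes> inv \<phi> k" for k l
    by (rule \<phi>.commute_inv[OF \<phi>_units \<phi>.closed \<phi>.commute])
  then have C: "inv ?m z \<otimes> ?p w = ?p w \<otimes> inv ?m z" "inv ?m z \<otimes> inv ?m w = inv ?m w \<otimes> inv ?m z"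
    by (auto intro!: \<phi>.commute_inv simp: \<phi>_units)
  have "int_extension (\<lambda>n. z n + w n) =
      \<phi> (\<lambda>n. nat (z n) + nat (w n)) \<otimes> inv \<phi> (\<lambda>n. nat (- z n) + nat (- w n))"
    by (rule int_extension_eqI) simp
  also have "\<dots> = (?p z \<otimes> ?p w) \<otimes> (inv ?m w \<otimes> inv ?m z)"
    by (simp add: \<phi>.hom_add \<phi>.inv_mult_units \<phi>_units)
  also have "\<dots> = int_extension z \<otimes> int_extension w"
    using C by (simp add: int_extension_def \<phi>_units \<phi>.m_assoc) (metis \<phi>.Units_inv_closed \<phi>.closed \<phi>_units \<phi>.m_assoc)
  finally show "int_extension (z \<otimes>\<^bsub>product_group UNIV (\<lambda>_. integer_group)\<^esub> w) =
      int_extension z \<otimes>\<^bsub>units_of G\<^esub> int_extension w"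
    by (simp add: units_of_def restrict_def)
qed

lemma int_extension_single_not_central:
  "int_extension (\<lambda>m. of_bool (m = n)) \<notin> center (units_of G)"
proof -
  have "int_extension (\<lambda>m. of_bool (m = n)) = \<phi> (\<chi> {n}) \<otimes> inv (\<phi> (\<lambda>_. 0))"
    by (rule int_extension_eqI) simp
  then show ?thesis using noncommute[of n] \<psi>_units
    by (auto simp: center_def units_of_def \<phi>.hom_zero)
qed

end

lemma mem_if_coset_eq_coset_one:
  assumes "monoid H" "\<one>\<^bsub>H\<^esub> \<in> C" "z \<in> carrier H" "C \<subseteq> carrier H" "C #>\<^bsub>H\<^esub> z = C #>\<^bsub>H\<^esub> \<one>\<^bsub>H\<^esub>"
  shows "z \<in> C"
proof -
  interpret monoid H by fact
  have "\<one>\<^bsub>H\<^esub> \<otimes>\<^bsub>H\<^esub> z \<in> C #>\<^bsub>H\<^esub> z" using assms(2) unfolding r_coset_def by blast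
  then obtain c where "c \<in> C" "z = c \<otimes>\<^bsub>H\<^esub> \<one>\<^bsub>H\<^esub>"
    using assms unfolding assms(5) r_coset_def by auto
  then show ?thesis using assms(4) by auto
qed

text \<open>The unit vector at \<open>n\<close> is supported on \<open>{n}\<close>, but its image is not central, as it fails to
  commute with \<open>\<psi> (\<chi> {n})\<close>.\<close>
lemma (in exponent_hom_pair) int_extension_not_factors:
  "\<not> factors_through_ultraproducts UNIV (\<lambda>_. integer_group) (units_of G Mod center (units_of G))
    (\<lambda>x. center (units_of G) #>\<^bsub>units_of G\<^esub> int_extension x)"
proof (rule not_factors_if_point_supported_images_nontrivial[where x = "\<lambda>n m. of_bool (m = n)"])
  fix n :: nat
  let ?C = "center (units_of G)"
  have one: "int_extension \<one>\<^bsub>product_group UNIV (\<lambda>_. integer_group)\<^esub> = \<one>\<^bsub>units_of G\<^esub>"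
    by (simp add: int_extension_def restrict_def \<phi>.hom_zero units_of_def)
  interpret U: group "units_of G" by (rule \<phi>.units_group)
  have "\<one>\<^bsub>units_of G\<^esub> \<in> ?C" by (simp add: center_def)
  moreover have "int_extension (\<lambda>m. of_bool (m = n)) \<in> carrier (units_of G)"
    using int_extension_hom by (auto simp: hom_def)
  moreover have "?C \<subseteq> carrier (units_of G)" by (auto simp: center_def)
  ultimately show "?C #>\<^bsub>units_of G\<^esub> int_extension (\<lambda>m. of_bool (m = n)) \<noteq>
      ?C #>\<^bsub>units_of G\<^esub> int_extension \<one>\<^bsub>product_group UNIV (\<lambda>_. integer_group)\<^esub>"
    using mem_if_coset_eq_coset_one[OF U.is_monoid]
      int_extension_single_not_central[of n] unfolding one by blast
qed (auto intro: group.is_monoid)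

section \<open>Null sets of a homomorphism on a product\<close>

locale product_hom = B: monoid B for B :: "'b monoid" (structure) +
  fixes I :: "'i set" and M :: "'i \<Rightarrow> ('m, 'c) monoid_scheme" and f :: "('i \<Rightarrow> 'm) \<Rightarrow> 'b"
  assumes M: "\<And>i. i \<in> I \<Longrightarrow> monoid (M i)"
    and f_hom: "f \<in> monoid_hom (product_group I M) B"
begin

abbreviation "P \<equiv> product_group I M"

lemma f_closed: "x \<in> carrier P \<Longrightarrow> f x \<in> carrier B"
  and f_mult: "x \<in> carrier P \<Longrightarrow> y \<in> carrier P \<Longrightarrow> f (x \<otimes>\<^bsub>P\<^esub> y) = f x \<otimes> f y"
  and f_one: "f \<one>\<^bsub>P\<^esub> = \<one>"
  using f_hom by (auto simp: monoid_hom_def hom_def)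

lemma product_eqI:
  "x \<in> carrier P \<Longrightarrow> y \<in> carrier P \<Longrightarrow> (\<And>i. i \<in> I \<Longrightarrow> x i = y i) \<Longrightarrow> x = y"
  by (auto intro: PiE_ext)

lemma product_app: "x \<in> carrier P \<Longrightarrow> i \<in> I \<Longrightarrow> x i \<in> carrier (M i)"
  by auto

definition part :: "'i set \<Rightarrow> ('i \<Rightarrow> 'm) \<Rightarrow> 'i \<Rightarrow> 'm"
  where "part Y x = (\<lambda>i\<in>I. if i \<in> Y then x i else \<one>\<^bsub>M i\<^esub>)"

lemma part_app: "i \<in> I \<Longrightarrow> part Y x i = (if i \<in> Y then x i else \<one>\<^bsub>M i\<^esub>)"
  by (simp add: part_def)

lemma part_closed: "x \<in> carrier P \<Longrightarrow> part Y x \<in> carrier P"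
  using monoid.one_closed[OF M] by (auto simp: part_def)

lemma part_mult_part:
  assumes "x \<in> carrier P" "Y \<inter> Z = {}"
  shows "part Y x \<otimes>\<^bsub>P\<^esub> part Z x = part (Y \<union> Z) x"
proof (rule product_eqI)
  fix i assume i: "i \<in> I"
  then interpret monoid "M i" by (rule M)
  show "(part Y x \<otimes>\<^bsub>P\<^esub> part Z x) i = part (Y \<union> Z) x i"
    using product_app[OF assms(1) i] assms(2) i by (auto simp: part_app)
qed (intro product_mult_closed M part_closed assms; assumption)+

lemma part_UNIV: "x \<in> carrier P \<Longrightarrow> part UNIV x = x"
  by (rule product_eqI[OF part_closed]) (auto simp: part_app)

lemma f_part_split:
  assumes "x \<in> carrier P"
  shows "f x = f (part (- Y) x) \<otimes> f (part Y x)"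
  using assms part_mult_part[OF assms, of "- Y" Y]
  by (simp add: part_UNIV part_closed flip: f_mult del: mult_product_group carrier_product_group)

lemma f_commute_disjoint:
  assumes "x \<in> carrier P" "y \<in> carrier P"
    and "\<And>i. i \<in> I \<Longrightarrow> x i = \<one>\<^bsub>M i\<^esub> \<or> y i = \<one>\<^bsub>M i\<^esub>"
  shows "f x \<otimes> f y = f y \<otimes> f x"
proof -
  have "x \<otimes>\<^bsub>P\<^esub> y = y \<otimes>\<^bsub>P\<^esub> x"
  proof (rule product_eqI)
    fix i assume i: "i \<in> I"
    then interpret monoid "M i" by (rule M)
    show "(x \<otimes>\<^bsub>P\<^esub> y) i = (y \<otimes>\<^bsub>P\<^esub> x) i"
      using assms(3)[OF i] product_app[OF assms(1) i] product_app[OF assms(2) i] i by auto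
  qed (intro product_mult_closed M assms; assumption)+
  then show ?thesis using assms by (metis f_mult)
qed

definition null :: "'i set \<Rightarrow> bool"
  where "null Y \<longleftrightarrow> (\<forall>x\<in>carrier P. f (part Y x) \<in> central_units B)"

lemma null_empty: "null {}"
proof -
  have "part {} x = \<one>\<^bsub>P\<^esub>" for x by (simp add: part_def)
  then show ?thesis by (simp only: null_def f_one) (blast intro: B.one_central_units)
qed

lemma null_subset:
  assumes "Y \<subseteq> Z" "null Z"
  shows "null Y"
proof -
  have "part Z (part Y x) = part Y x" if "x \<in> carrier P" for x
    using that assms(1) by (intro product_eqI part_closed) (auto simp: part_app)
  then show ?thesis using assms(2) part_closed unfolding null_def by metis
qed

lemma null_Un:
  assumes "null Y" "null Z"
  shows "null (Y \<union> Z)"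
proof -
  have "null (Z - Y)" using null_subset[OF _ assms(2)] by blast
  moreover have "f (part (Y \<union> Z) x) = f (part Y x) \<otimes> f (part (Z - Y) x)" if "x \<in> carrier P" for x
    using part_mult_part[OF that, of Y "Z - Y"] that
    by (simp add: part_closed flip: f_mult del: mult_product_group carrier_product_group)
  ultimately show ?thesis using assms(1) unfolding null_def by (metis B.mult_central_units)
qed

lemma null_UN: "finite K \<Longrightarrow> (\<And>k. k \<in> K \<Longrightarrow> null (A k)) \<Longrightarrow> null (\<Union>k\<in>K. A k)"
  by (induction K rule: finite_induct) (auto intro: null_empty null_Un)

abbreviation coset ("\<pi>")
  where "\<pi> b \<equiv> central_units B #> b"

text \<open>Splitting \<open>x\<close> into its part on the set where \<open>x\<close> and \<open>y\<close> differ and its part on the complement,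
  the first part contributes a central unit only, and the second part is shared with \<open>y\<close>.\<close>
lemma coset_eq_if_differ_null:
  assumes x: "x \<in> carrier P" and y: "y \<in> carrier P" and "null {i \<in> I. x i \<noteq> y i}"
  shows "\<pi> (f x) = \<pi> (f y)"
proof -
  let ?D = "{i \<in> I. x i \<noteq> y i}"
  have agree: "part (- ?D) x = part (- ?D) y"
    by (rule product_eqI[OF part_closed[OF x] part_closed[OF y]]) (auto simp: part_app)
  have drop: "\<pi> (f z) = \<pi> (f (part (- ?D) z))" if "z \<in> carrier P" for z
  proof -
    have "f (part ?D z) \<in> central_units B" using assms(3) that by (simp only: null_def)
    then show ?thesis
      using B.central_units_coset_absorb[OF f_closed[OF part_closed[OF that, of "- ?D"]]]
        f_part_split[OF that, of ?D] by simp
  qed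
  show ?thesis by (subst (1 2) drop) (simp_all only: x y agree)
qed

end

section \<open>Finitely many atoms give a factorization\<close>

context product_hom
begin

definition atom_filter :: "'i set \<Rightarrow> 'i filter"
  where "atom_filter A = Abs_filter (\<lambda>P. null (A \<inter> {i. \<not> P i}))"

lemma eventually_atom_filter: "eventually Q (atom_filter A) \<longleftrightarrow> null (A \<inter> {i. \<not> Q i})"
  unfolding atom_filter_def
proof (rule eventually_Abs_filter, rule is_filter.intro)
  show "null (A \<inter> {i. \<not> True})" using null_empty by simp
next
  fix Q R assume "null (A \<inter> {i. \<not> Q i})" "null (A \<inter> {i. \<not> R i})"
  then show "null (A \<inter> {i. \<not> (Q i \<and> R i)})"
    by (rule null_subset[OF _ null_Un, rotated]) auto
next
  fix Q R assume "\<forall>i. Q i \<longrightarrow> R i" "null (A \<inter> {i. \<not> Q i})"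
  then show "null (A \<inter> {i. \<not> R i})"
    by (elim null_subset[rotated]) auto
qed

text \<open>That an atom cannot be split is exactly the ultrafilter property; that it is not null makes the
  filter proper.\<close>
lemma ultrafilter_atom_filter:
  assumes "A \<subseteq> I" "\<not> null A" "\<And>Y. null (A \<inter> Y) \<or> null (A - Y)"
  shows "ultrafilter_on I (atom_filter A)"
proof -
  have "atom_filter A \<noteq> bot"
    using assms(2) by (auto simp: trivial_limit_def eventually_atom_filter)
  moreover have "A \<inter> {i. i \<notin> I} = {}" using assms(1) by auto
  moreover have "null (A \<inter> {i. \<not> Q i}) \<or> null (A \<inter> {i. Q i})" for Q
    using assms(3)[of "{i. Q i}"] by (simp add: set_diff_eq Int_def disj_commute)
  ultimately show ?thesis
    by (simp add: ultrafilter_on_def eventually_atom_filter null_empty)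
qed

text \<open>Two elements that agree almost everywhere for the ultrafilters of all the atoms differ only on a null
  set, so \<open>\<pi> \<circ> f\<close> depends only on the classes in the ultraproducts. A homomorphism has to be defined on
  the whole product of the ultraproducts; since the atoms are disjoint, any choice of classes, one for
  each atom, comes from a single element of the product, obtained by gluing representatives along
  the atoms.\<close>
lemma factors_through_ultraproducts_if_finite_atoms:
  assumes fin: "finite \<A>" and disj: "disjoint \<A>"
    and atoms: "\<And>A. A \<in> \<A> \<Longrightarrow> A \<subseteq> I" "\<And>A. A \<in> \<A> \<Longrightarrow> \<not> null A"
      "\<And>A Y. A \<in> \<A> \<Longrightarrow> null (A \<inter> Y) \<or> null (A - Y)"
    and rest: "null (I - \<Union>\<A>)"
  shows "factors_through_ultraproducts I M (B Mod central_units B) (\<lambda>x. \<pi> (f x))"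
proof -
  obtain n A where inj: "inj_on A {..<n::nat}" and A: "\<A> = A ` {..<n}"
    using finite_imp_nat_seg_image_inj_on[OF fin] by (metis lessThan_def)
  define U where "U k = atom_filter (A k)" for k
  define r where "r k = ultra_rel I M (U k)" for k
  have equiv: "equiv (carrier P) (r k)" for k
    unfolding r_def by (rule equiv_ultra_rel[OF M])
  define Q where "Q = product_group {..<n} (\<lambda>k. ultraproduct I M (U k))"
  \<comment> \<open>The atoms are disjoint, so a point lies in at most one of them.\<close>
  define index where "index i = (THE k. k < n \<and> i \<in> A k)" for i
  have index: "index i = k" if "k < n" "i \<in> A k" for i k
  proof -
    have "l = k" if "l < n" "i \<in> A l" for l
      using that \<open>k < n\<close> \<open>i \<in> A k\<close> inj disjointD[OF disj, of "A k" "A l"]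
      unfolding A inj_on_def by blast
    then show ?thesis using that unfolding index_def by blast
  qed
  define rep where "rep p = (SOME x. x \<in> p)" for p :: "('i \<Rightarrow> 'm) set"
  define glue where "glue q = (\<lambda>i\<in>I. if i \<in> \<Union>\<A> then rep (q (index i)) i else \<one>\<^bsub>M i\<^esub>)"
    for q :: "nat \<Rightarrow> ('i \<Rightarrow> 'm) set"
  define h where "h q = \<pi> (f (glue q))" for q
  have coset_eq: "\<pi> (f x) = \<pi> (f y)" if "x \<in> carrier P" "y \<in> carrier P" "\<And>k. k < n \<Longrightarrow> (x, y) \<in> r k" for x y
  proof (rule coset_eq_if_differ_null[OF that(1,2)])
    have "null (A k \<inter> {i. x i \<noteq> y i})" if "k < n" for k
      using \<open>\<And>k. k < n \<Longrightarrow> (x, y) \<in> r k\<close>[OF that]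
      by (simp add: r_def ultra_rel_def U_def eventually_atom_filter)
    then have "null ((I - \<Union>\<A>) \<union> (\<Union>k<n. A k \<inter> {i. x i \<noteq> y i}))"
      by (intro null_Un rest null_UN) auto
    then show "null {i \<in> I. x i \<noteq> y i}"
      by (rule null_subset[rotated]) (auto simp: A)
  qed
  have rep: "rep p \<in> carrier P" "p = r k `` {rep p}" if p: "p \<in> carrier P // r k" for p k
  proof -
    obtain x where x: "x \<in> carrier P" "p = r k `` {x}" using p by (blast elim: quotientE)
    then have "x \<in> p" using equiv by (metis equiv_class_self)
    then have "rep p \<in> p" unfolding rep_def by (rule someI[where P = "\<lambda>x. x \<in> p"])
    then have related: "(x, rep p) \<in> r k" using x by simp
    then show "rep p \<in> carrier P" by (simp add: r_def ultra_rel_def del: carrier_product_group)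
    show "p = r k `` {rep p}" using x(2) equiv_class_eq[OF equiv related] by simp
  qed
  have class_eq_iff: "r k `` {x} = r k `` {y} \<longleftrightarrow> (x, y) \<in> r k" if "x \<in> carrier P" "y \<in> carrier P" for x y k
    using eq_equiv_class_iff[OF equiv that] .
  have carrier_Q: "q k \<in> carrier P // r k" if "q \<in> carrier Q" "k < n" for q k
    using that by (auto simp: Q_def ultraproduct_def r_def simp del: carrier_product_group[of I M])
  have glue_closed: "glue q \<in> carrier P" if "q \<in> carrier Q" for q
  proof -
    have "rep (q (index i)) i \<in> carrier (M i)" if "i \<in> I" "i \<in> \<Union>\<A>" for i
    proof -
      obtain k where k: "k < n" "i \<in> A k" using \<open>i \<in> \<Union>\<A>\<close> by (auto simp: A)
      have "rep (q k) \<in> carrier P" by (rule rep(1)[OF carrier_Q[OF \<open>q \<in> carrier Q\<close> k(1)]])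
      then show ?thesis using product_app[OF _ \<open>i \<in> I\<close>] index[OF k] by simp
    qed
    then show ?thesis using monoid.one_closed[OF M] by (auto simp: glue_def)
  qed
  have glue_class: "r k `` {glue q} = q k" if "q \<in> carrier Q" "k < n" for q k
  proof -
    note p = rep[OF carrier_Q[OF that]]
    have "A k \<inter> {i. glue q i \<noteq> rep (q k) i} = {}"
      using that index[of k] atoms(1)[of "A k"] by (auto simp: glue_def A)
    then have "(glue q, rep (q k)) \<in> r k"
      using glue_closed[OF that(1)] p(1)
      by (simp add: r_def ultra_rel_def U_def eventually_atom_filter null_empty del: carrier_product_group)
    then have "r k `` {glue q} = r k `` {rep (q k)}" by (rule equiv_class_eq[OF equiv])
    then show ?thesis using p(2) by simp
  qed
  have "h \<in> monoid_hom Q (B Mod central_units B)"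
    unfolding monoid_hom_def
  proof (intro CollectI conjI homI)
    show "h q \<in> carrier (B Mod central_units B)" if "q \<in> carrier Q" for q
      using f_closed[OF glue_closed[OF that]] by (auto simp: h_def carrier_FactGroup)
  next
    fix q q' assume q: "q \<in> carrier Q" "q' \<in> carrier Q"
    have prod: "(q \<otimes>\<^bsub>Q\<^esub> q') k = r k `` {glue q \<otimes>\<^bsub>P\<^esub> glue q'}" if "k < n" for k
    proof -
      have "(q \<otimes>\<^bsub>Q\<^esub> q') k = r k `` {glue q} \<otimes>\<^bsub>ultraproduct I M (U k)\<^esub> r k `` {glue q'}"
        using that q by (simp add: Q_def glue_class[unfolded Q_def])
      also have "\<dots> = r k `` {glue q \<otimes>\<^bsub>P\<^esub> glue q'}"
        unfolding r_def by (rule ultraproduct_mult[OF M]) (use q glue_closed in auto)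
      finally show ?thesis .
    qed
    have P: "glue q \<otimes>\<^bsub>P\<^esub> glue q' \<in> carrier P"
      by (rule product_mult_closed[OF M]) (use q glue_closed in auto)
    have qq': "q \<otimes>\<^bsub>Q\<^esub> q' \<in> carrier Q"
    proof -
      have "(q \<otimes>\<^bsub>Q\<^esub> q') k \<in> carrier (ultraproduct I M (U k))" if "k < n" for k
        using prod[OF that] quotientI[OF P, of "r k"] by (simp add: ultraproduct_def r_def)
      then show ?thesis by (simp add: Q_def)
    qed
    have "(glue (q \<otimes>\<^bsub>Q\<^esub> q'), glue q \<otimes>\<^bsub>P\<^esub> glue q') \<in> r k" if "k < n" for k
      using glue_class[OF qq' that] prod[OF that]
      by (simp only: class_eq_iff[OF glue_closed[OF qq'] P, symmetric])
    then have "\<pi> (f (glue (q \<otimes>\<^bsub>Q\<^esub> q'))) = \<pi> (f (glue q \<otimes>\<^bsub>P\<^esub> glue q'))"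
      by (rule coset_eq[OF glue_closed[OF qq'] P])
    then show "h (q \<otimes>\<^bsub>Q\<^esub> q') = h q \<otimes>\<^bsub>B Mod central_units B\<^esub> h q'"
      using q by (simp add: h_def f_mult f_closed glue_closed B.central_units_coset_mult
          del: mult_product_group carrier_product_group)
  next
    have one: "\<one>\<^bsub>P\<^esub> \<in> carrier P" by (rule product_one_closed[OF M])
    have one_k: "\<one>\<^bsub>Q\<^esub> k = r k `` {\<one>\<^bsub>P\<^esub>}" if "k < n" for k
      using that by (simp add: Q_def ultraproduct_def r_def)
    have oneQ: "\<one>\<^bsub>Q\<^esub> \<in> carrier Q"
    proof -
      have "\<one>\<^bsub>Q\<^esub> k \<in> carrier (ultraproduct I M (U k))" if "k < n" for k
        using one_k[OF that] quotientI[OF one, of "r k"] by (simp add: ultraproduct_def r_def)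
      then show ?thesis by (simp add: Q_def)
    qed
    have "(glue \<one>\<^bsub>Q\<^esub>, \<one>\<^bsub>P\<^esub>) \<in> r k" if "k < n" for k
      using glue_class[OF oneQ that] one_k[OF that]
      by (simp only: class_eq_iff[OF glue_closed[OF oneQ] one, symmetric])
    then have "\<pi> (f (glue \<one>\<^bsub>Q\<^esub>)) = \<pi> (f \<one>\<^bsub>P\<^esub>)"
      by (rule coset_eq[OF glue_closed[OF oneQ] one])
    then show "h \<one>\<^bsub>Q\<^esub> = \<one>\<^bsub>B Mod central_units B\<^esub>"
      by (simp add: h_def f_one B.central_units_coset_self del: one_product_group)
  qed
  moreover have "\<pi> (f x) = h (\<lambda>k\<in>{..<n}. r k `` {x})" if x: "x \<in> carrier P" for x
  proof -
    let ?q = "\<lambda>k\<in>{..<n}. r k `` {x}"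
    have q: "?q \<in> carrier Q"
      using quotientI[OF x] by (simp add: Q_def ultraproduct_def r_def)
    have "(x, glue ?q) \<in> r k" if "k < n" for k
      using glue_class[OF q that] that by (simp flip: class_eq_iff[OF x glue_closed[OF q]])
    then show ?thesis unfolding h_def
      by (rule coset_eq[OF x glue_closed[OF q]])
  qed
  moreover have "\<forall>k<n. ultrafilter_on I (U k)"
  proof (intro allI impI)
    fix k assume "k < n"
    then have "A k \<in> \<A>" by (simp add: A)
    then show "ultrafilter_on I (U k)" unfolding U_def by (intro ultrafilter_atom_filter atoms)
  qed
  ultimately show ?thesis
    unfolding factors_through_ultraproducts_def Q_def r_def by blast
qed

end

section \<open>Infinitely many non-null sets\<close>

context product_hom
begin

text \<open>The infinite product of the powers of the \<open>x n\<close>, each cut down to \<open>S n\<close>. It is meant for disjoint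
  sets \<open>S n\<close>, where at each coordinate at most one factor is different from the identity.\<close>
definition powers :: "(nat \<Rightarrow> 'i set) \<Rightarrow> (nat \<Rightarrow> 'i \<Rightarrow> 'm) \<Rightarrow> (nat \<Rightarrow> nat) \<Rightarrow> 'i \<Rightarrow> 'm"
  where "powers S x k = (\<lambda>i\<in>I. if i \<in> (\<Union>n. S n)
    then let n = THE n. i \<in> S n in x n i [^]\<^bsub>M i\<^esub> k n else \<one>\<^bsub>M i\<^esub>)"

context
  fixes S :: "nat \<Rightarrow> 'i set"
  assumes S: "disjoint_family S"
begin

lemma powers_inside: "i \<in> I \<Longrightarrow> i \<in> S n \<Longrightarrow> powers S x k i = x n i [^]\<^bsub>M i\<^esub> k n"
proof -
  assume i: "i \<in> I" "i \<in> S n"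
  then have "(THE n. i \<in> S n) = n"
    using S by (auto simp: disjoint_family_on_def)
  then show ?thesis using i by (auto simp: powers_def)
qed

lemma powers_outside: "i \<in> I \<Longrightarrow> (\<And>n. i \<notin> S n) \<Longrightarrow> powers S x k i = \<one>\<^bsub>M i\<^esub>"
  by (auto simp: powers_def)

lemma powers_closed:
  assumes "\<And>n. x n \<in> carrier P"
  shows "powers S x k \<in> carrier P"
proof -
  have "powers S x k i \<in> carrier (M i)" if i: "i \<in> I" for i
  proof -
    interpret monoid "M i" using i by (rule M)
    show ?thesis
      using powers_inside[OF i] powers_outside[OF i] product_app[OF assms i]
      by (cases "\<exists>n. i \<in> S n") auto
  qed
  then show ?thesis by (auto simp: powers_def)
qed

lemma powers_single:
  assumes "\<And>n. x n \<in> carrier P"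
  shows "powers S x (\<chi> {n}) = part (S n) (x n)"
proof (rule product_eqI[OF powers_closed[OF assms] part_closed[OF assms]])
  fix i assume i: "i \<in> I"
  interpret monoid "M i" using i by (rule M)
  show "powers S x (\<chi> {n}) i = part (S n) (x n) i"
  proof (cases "\<exists>m. i \<in> S m")
    case True
    then obtain m where m: "i \<in> S m" by blast
    have "i \<in> S n \<longleftrightarrow> m = n" using m S by (auto simp: disjoint_family_on_def)
    then show ?thesis
      using powers_inside[OF i m] product_app[OF assms i] i by (auto simp: part_app)
  next
    case False
    then show ?thesis using powers_outside[OF i] i by (auto simp: part_app)
  qed
qed

lemma exponent_hom_powers:
  assumes x: "\<And>n. x n \<in> carrier P"
  shows "exponent_hom B (\<lambda>k. f (powers S x k))"
proof unfold_locales
  show "f (powers S x k) \<in> carrier B" for k by (intro f_closed powers_closed[where x = x] x)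
  have "powers S x (\<lambda>_. 0) = \<one>\<^bsub>P\<^esub>" by (auto simp: powers_def)
  then show "f (powers S x (\<lambda>_. 0)) = \<one>" using f_one by simp
  fix k l
  have "powers S x (\<lambda>n. k n + l n) = powers S x k \<otimes>\<^bsub>P\<^esub> powers S x l"
  proof (rule product_eqI)
    fix i assume i: "i \<in> I"
    interpret monoid "M i" using i by (rule M)
    show "powers S x (\<lambda>n. k n + l n) i = (powers S x k \<otimes>\<^bsub>P\<^esub> powers S x l) i"
      using powers_inside[OF i] powers_outside[OF i] product_app[OF x i] i
      by (cases "\<exists>n. i \<in> S n") (auto simp: nat_pow_mult)
  qed (intro product_mult_closed M powers_closed[where x = x] x; assumption)+
  then show "f (powers S x (\<lambda>n. k n + l n)) = f (powers S x k) \<otimes> f (powers S x l)"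
    by (simp only: f_mult powers_closed[where x = x, OF x])
qed

lemma powers_commute_disjoint:
  assumes x: "\<And>n. x n \<in> carrier P" and y: "\<And>n. y n \<in> carrier P"
    and "\<And>n. k n = 0 \<or> l n = 0"
  shows "f (powers S x k) \<otimes> f (powers S y l) = f (powers S y l) \<otimes> f (powers S x k)"
proof (rule f_commute_disjoint[OF powers_closed[where x = x, OF x] powers_closed[where x = y, OF y]])
  fix i assume i: "i \<in> I"
  interpret monoid "M i" using i by (rule M)
  show "powers S x k i = \<one>\<^bsub>M i\<^esub> \<or> powers S y l i = \<one>\<^bsub>M i\<^esub>"
    using powers_inside[OF i] powers_outside[OF i] assms(3)
    by (cases "\<exists>n. i \<in> S n") (metis nat_pow_0, metis)
qed

lemma part_powers:
  assumes "\<And>n. x n \<in> carrier P" "\<And>n. S n \<subseteq> T"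
  shows "part T (powers S x k) = powers S x k"
proof (rule product_eqI[OF part_closed])
  fix i assume i: "i \<in> I"
  have "powers S x k i = \<one>\<^bsub>M i\<^esub>" if "i \<notin> T"
    using powers_outside[OF i] assms(2) that by blast
  then show "part T (powers S x k) i = powers S x k i"
    using i by (simp add: part_app)
qed (use assms powers_closed in blast)+

end

text \<open>A unit \<open>f x\<close> that is not central fails to commute with some \<open>f y\<close> because \<open>f\<close> is onto. If \<open>x\<close> is
  supported on \<open>S n\<close>, it commutes with the part of \<open>y\<close> outside \<open>S n\<close>, so \<open>y\<close> can be replaced by its
  part on \<open>S n\<close>. The infinite products are supported on \<open>T\<close>, which makes their images units.\<close>
lemma obtain_exponent_hom_pair:
  fixes S :: "nat \<Rightarrow> 'i set"
  assumes onto: "f ` carrier P = carrier B" and S: "disjoint_family S" "\<And>n. S n \<subseteq> T" "\<And>n. \<not> null (S n)"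
    and units: "\<And>x. x \<in> carrier P \<Longrightarrow> f (part T x) \<in> Units B"
  obtains \<phi> \<psi> where "exponent_hom_pair B \<phi> \<psi>"
proof -
  have "\<exists>x y. x \<in> carrier P \<and> y \<in> carrier P \<and>
      f (part (S n) x) \<otimes> f (part (S n) y) \<noteq> f (part (S n) y) \<otimes> f (part (S n) x)" for n
  proof -
    obtain x where x: "x \<in> carrier P" "f (part (S n) x) \<notin> central_units B"
      using S(3) unfolding null_def by blast
    let ?u = "f (part (S n) x)"
    have u: "?u \<in> carrier B" using x f_closed part_closed by blast
    have "part T (part (S n) x) = part (S n) x"
      using S(2)[of n] x(1) by (intro product_eqI part_closed) (auto simp: part_app)
    then have "?u \<in> Units B" using units[OF part_closed[OF x(1)], of "S n"] by simp
    then obtain b where "b \<in> carrier B" "?u \<otimes> b \<noteq> b \<otimes> ?u"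
      using x(2) unfolding B.central_units_iff by blast
    then obtain y where y: "y \<in> carrier P" "?u \<otimes> f y \<noteq> f y \<otimes> ?u"
      using onto by (metis imageE)
    let ?v = "f (part (S n) y)" and ?w = "f (part (- S n) y)"
    have vw: "?v \<in> carrier B" "?w \<in> carrier B" using y f_closed part_closed by blast+
    have w: "?w \<otimes> ?u = ?u \<otimes> ?w"
      using x(1) y(1) by (intro f_commute_disjoint part_closed) (auto simp: part_app)
    have "?u \<otimes> ?v \<noteq> ?v \<otimes> ?u"
    proof
      assume "?u \<otimes> ?v = ?v \<otimes> ?u"
      then have "(?w \<otimes> ?v) \<otimes> ?u = ?u \<otimes> (?w \<otimes> ?v)"
        by (intro B.commute_mult u vw w) simp
      then show False using y(2) f_part_split[OF y(1), of "S n"] by simp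
    qed
    then show ?thesis using x(1) y(1) by blast
  qed
  then obtain x y where xy: "\<And>n. x n \<in> carrier P" "\<And>n. y n \<in> carrier P"
    "\<And>n. f (part (S n) (x n)) \<otimes> f (part (S n) (y n)) \<noteq> f (part (S n) (y n)) \<otimes> f (part (S n) (x n))"
    by metis
  interpret \<phi>: exponent_hom B "\<lambda>k. f (powers S x k)" by (rule exponent_hom_powers[where x = x, OF S(1) xy(1)])
  interpret \<psi>: exponent_hom B "\<lambda>k. f (powers S y k)" by (rule exponent_hom_powers[where x = y, OF S(1) xy(2)])
  have "exponent_hom_pair B (\<lambda>k. f (powers S x k)) (\<lambda>k. f (powers S y k))"
  proof unfold_locales
    show "f (powers S x k) \<in> Units B" for k
      using units[OF powers_closed[where x = x, OF S(1) xy(1)], of k]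
        part_powers[where x = x, OF S(1) xy(1) S(2)] by simp
    show "f (powers S y k) \<in> Units B" for k
      using units[OF powers_closed[where x = y, OF S(1) xy(2)], of k]
        part_powers[where x = y, OF S(1) xy(2) S(2)] by simp
    show "f (powers S x k) \<otimes> f (powers S y l) = f (powers S y l) \<otimes> f (powers S x k)"
      if "\<And>n. k n = 0 \<or> l n = 0" for k l
      using powers_commute_disjoint[where x = x and y = y, OF S(1) xy(1,2) that] .
    show "f (powers S x (\<chi> {n})) \<otimes> f (powers S y (\<chi> {n})) \<noteq> f (powers S y (\<chi> {n})) \<otimes> f (powers S x (\<chi> {n}))" for n
      using xy(3) by (simp only: powers_single[where x = x, OF S(1) xy(1)] powers_single[where x = y, OF S(1) xy(2)] not_False_eq_True)
  qed
  then show thesis by (rule that)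
qed

text \<open>Even if each \<open>x n\<close> has a unit as its image, an infinite product of the \<open>x n\<close> may not. Therefore the
  non-null sets are grouped into infinitely many infinite rows: either one row supports only elements with
  unit images, or every row is itself the support of an element whose image is not a unit.\<close>
lemma exponent_hom_pair_or_nonunits:
  assumes onto: "f ` carrier P = carrier B"
    and "\<not> factors_through_ultraproducts I M (B Mod central_units B) (\<lambda>x. \<pi> (f x))"
  obtains (units) \<phi> \<psi> where "exponent_hom_pair B \<phi> \<psi>"
  | (nonunits) \<phi> where "exponent_hom B \<phi>" "\<And>n. \<phi> (\<chi> {n}) \<notin> Units B"
proof -
  have "\<exists>S. disjoint_family S \<and> (\<forall>n :: nat. \<not> null (S n))"
  proof (rule disjoint_sequence_or_finite_atoms[where null = null and R = I,
        OF null_empty null_subset null_Un])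
    fix S :: "nat \<Rightarrow> 'i set"
    assume "disjoint_family S" "\<And>n. \<not> null (S n)"
    then show ?thesis by blast
  next
    fix \<A>
    assume "finite \<A>" "disjoint \<A>" "\<And>A. A \<in> \<A> \<Longrightarrow> A \<subseteq> I" "\<And>A. A \<in> \<A> \<Longrightarrow> \<not> null A"
      "\<And>A Y. A \<in> \<A> \<Longrightarrow> null (A \<inter> Y) \<or> null (A - Y)" "null (I - \<Union>\<A>)"
    then have "factors_through_ultraproducts I M (B Mod central_units B) (\<lambda>x. \<pi> (f x))"
      by (rule factors_through_ultraproducts_if_finite_atoms)
    then show ?thesis using assms(2) by contradiction
  qed
  then obtain S where S: "disjoint_family S" "\<And>n :: nat. \<not> null (S n)" by blast
  define R where "R k m = S (prod_encode (k, m))" for k m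
  have disj: "R k m \<inter> R k' m' = {}" if "(k, m) \<noteq> (k', m')" for k m k' m'
    using disjoint_family_onD[OF S(1), of "prod_encode (k, m)" "prod_encode (k', m')"] that
    unfolding R_def by (simp only: prod_encode_eq UNIV_I simp_thms)
  define T where "T k = (\<Union>m. R k m)" for k
  show thesis
  proof (cases "\<forall>k. \<exists>x\<in>carrier P. f (part (T k) x) \<notin> Units B")
    case True
    then obtain x where x: "\<And>k. x k \<in> carrier P" "\<And>k. f (part (T k) (x k)) \<notin> Units B" by metis
    have T: "disjoint_family T"
      using disj unfolding T_def disjoint_family_on_def by fastforce
    show thesis
      by (rule nonunits[OF exponent_hom_powers[where x = x, OF T x(1)]])
        (simp only: powers_single[where x = x, OF T x(1)] x(2) not_False_eq_True)
  next
    case False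
    then obtain k where k: "\<And>x. x \<in> carrier P \<Longrightarrow> f (part (T k) x) \<in> Units B" by blast
    have "disjoint_family (R k)"
      using disj unfolding disjoint_family_on_def by simp
    moreover have "R k m \<subseteq> T k" "\<not> null (R k m)" for m
      unfolding R_def T_def using S(2) by blast+
    ultimately obtain \<phi> \<psi> where "exponent_hom_pair B \<phi> \<psi>"
      using obtain_exponent_hom_pair[where S = "R k", OF onto _ _ _ k] by blast
    then show thesis by (rule units)
  qed
qed

end

section \<open>Families indexed by the sets of natural numbers\<close>

(* The types of J and of the groups G j have to be fixed to state their existence. The choice made
   here (indices in nat, carriers in int) gives the strongest existence claim and loses no generality:
   if some family of groups on an arbitrary index set has a homomorphism g as in (a), then the index
   set contains infinitely many disjoint subsets S n for which some x n supported on S n has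
   non-central image, and (k n) |-> g (prod of the (x n)^(k n)) is such a homomorphism on the product
   of countably many copies of the integers.
   f is taken to be onto B: without f_onto the claim is false. For example, let A be the product of countably
   many copies of the integers, B the semidirect product of A with the additive monoid of naturals
   where 1 acts on A by inversion, and f the inclusion of A into B.
   "c is a right multiple of a" is "a divides c". *)
theorem theorem42:
  fixes B :: "'b monoid" and I :: "'i set" and M :: "'i \<Rightarrow> 'm monoid"
    and f :: "('i \<Rightarrow> 'm) \<Rightarrow> 'b"
  assumes B: "monoid B"
    and cancel: "\<And>x y. x \<in> carrier B \<Longrightarrow> y \<in> carrier B \<Longrightarrow> x \<otimes>\<^bsub>B\<^esub> y = x \<Longrightarrow> y = \<one>\<^bsub>B\<^esub>"
    and M: "\<And>i. i \<in> I \<Longrightarrow> monoid (M i)"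
    and f_hom: "f \<in> monoid_hom (product_group I M) B"
    and f_onto: "f ` carrier (product_group I M) = carrier B"
    and not_factors: "\<not> factors_through_ultraproducts I M (B Mod central_units B)
        (\<lambda>x. central_units B #>\<^bsub>B\<^esub> f x)"
  shows
    "((\<exists>(J :: nat set) (G :: nat \<Rightarrow> int monoid) g.
          (\<forall>j\<in>J. group (G j)) \<and>
          g \<in> hom (product_group J G) (units_of B) \<and>
          \<not> factors_through_ultraproducts J G (units_of B Mod center (units_of B))
              (\<lambda>x. center (units_of B) #>\<^bsub>units_of B\<^esub> g x)) \<and>
      (\<exists>a b :: nat set \<Rightarrow> 'b.
          (\<forall>S. a S \<in> Units B \<and> b S \<in> Units B) \<and>
          (\<forall>S T. a S \<otimes>\<^bsub>B\<^esub> a T = a T \<otimes>\<^bsub>B\<^esub> a S) \<and>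
          (\<forall>S T. b S \<otimes>\<^bsub>B\<^esub> b T = b T \<otimes>\<^bsub>B\<^esub> b S) \<and>
          (\<forall>S T. S \<inter> T = {} \<longrightarrow>
              a S \<otimes>\<^bsub>B\<^esub> a T = a (S \<union> T) \<and>
              b S \<otimes>\<^bsub>B\<^esub> b T = b (S \<union> T) \<and>
              a S \<otimes>\<^bsub>B\<^esub> b T = b T \<otimes>\<^bsub>B\<^esub> a S) \<and>
          (\<forall>S T. card (S \<inter> T) = 1 \<longrightarrow> a S \<otimes>\<^bsub>B\<^esub> b T \<noteq> b T \<otimes>\<^bsub>B\<^esub> a S)))
     \<or> (\<exists>a :: nat set \<Rightarrow> 'b.
          (\<forall>S. a S \<in> carrier B) \<and>
          a {} = \<one>\<^bsub>B\<^esub> \<and>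
          (\<forall>S T. a S \<otimes>\<^bsub>B\<^esub> a T = a T \<otimes>\<^bsub>B\<^esub> a S) \<and>
          (\<forall>S T. S \<inter> T = {} \<longrightarrow> a S \<otimes>\<^bsub>B\<^esub> a T = a (S \<union> T)) \<and>
          (\<forall>S T. S \<subset> T \<longrightarrow> a S divides\<^bsub>B\<^esub> a T \<and> \<not> a T divides\<^bsub>B\<^esub> a S))"
    (is "(?hom \<and> ?pair) \<or> ?nonunits")
proof -
  interpret product_hom B I M f
    using B M f_hom by (simp add: product_hom_def product_hom_axioms_def)
  show ?thesis
  proof (cases rule: exponent_hom_pair_or_nonunits[OF f_onto not_factors])
    case (1 \<phi> \<psi>)
    then interpret exponent_hom_pair B \<phi> \<psi> .
    have ?hom
      using int_extension_hom int_extension_not_factors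
      by (intro exI[of _ "UNIV :: nat set"] exI[of _ "\<lambda>_. integer_group"]
          exI[of _ int_extension] conjI ballI group_integer_group)
    moreover have ?pair
    proof (rule exI[of _ "\<lambda>S. \<phi> (\<chi> S)"], rule exI[of _ "\<lambda>S. \<psi> (\<chi> S)"], intro conjI allI impI)
      fix S T :: "nat set" assume "S \<inter> T = {}"
      then show "\<phi> (\<chi> S) \<otimes>\<^bsub>B\<^esub> \<psi> (\<chi> T) = \<psi> (\<chi> T) \<otimes>\<^bsub>B\<^esub> \<phi> (\<chi> S)"
        by (intro disjoint_commute) auto
    qed (intro \<phi>_units \<psi>_units \<phi>.commute \<psi>.commute \<phi>.union \<psi>.union
        not_commute_if_card_Int_eq_1; assumption)+
    ultimately show ?thesis by blast
  next
    case (2 \<phi>)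
    then interpret exponent_hom B \<phi> by blast
    have ?nonunits
      by (intro exI[of _ "\<lambda>S. \<phi> (\<chi> S)"] conjI allI impI closed empty commute union
          divides_strict[OF cancel 2(2)]; assumption)
    then show ?thesis by blast
  qed
qed
end
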